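(* Let $\kappa$ be an uncountable cardinal and let $\mathscr U$ be a normal $\kappa$-complete nonprincipal ultrafilter on $\kappa$. Then $B(\kappa_{\mathscr U})$ is a nondiscrete Hausdorff extremally disconnected topological group. Moreover, all subsets of cardinality less than $\kappa$ in $B(\kappa_{\mathscr U})$ are closed and discrete, and $B(\kappa_{\mathscr U})$ is a $P_\kappa$-space, i.e., the intersection of any family of fewer than $\kappa$ open sets in $B(\kappa_{\mathscr U})$ is open.
   Context: A topological space is extremally disconnected if the closure of any open set is open. For an uncountable cardinal $\kappa$, a filter $\mathscr F$ is $\kappa$-complete if $\bigcap_{\alpha<\lambda}A_\alpha\in\mathscr F$ for any cardinal $\lambda<\kappa$ and any $A_\alpha\in\mathscr F$, $\alpha<\lambda$. For an ordinal $\delta$ and sets $X_\alpha\subset\delta$ ($\alpha<\delta$), the diagonal intersection of the sequence $(X_\alpha)_{\alpha<\delta}$ is $\Delta_{\alpha<\delta}X_\alpha=\{\alpha<\delta:\alpha\in\bigcap_{\beta<\alpha}X_\beta\}$. A filter $\mathscr F$ on a cardinal $\kappa$ is normal if it is closed under diagonal intersections, i.e. $\Delta_{\alpha<\kappa}X_\alpha\in\mathscr F$ whenever $X_\alpha\in\mathscr F$ for all $\alpha<\kappa$. The set $[\kappa]^{<\omega}$ of all finite subsets of $\kappa$ is a group under symmetric difference $\triangle$ (it is the Boolean group freely generated by $\kappa$, where $\alpha\in\kappa$ is identified with $\{\alpha\}$, and its zero element $\mathbf 0$ is $\varnothing$). For a filter $\mathscr F$ on $\kappa$, the subgroups $\langle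 A\rangle$ generated by $A\in\mathscr F$ (that is, $\langle A\rangle$ is the set of all finite subsets of $A$) form a base of neighborhoods of zero for a group topology on $[\kappa]^{<\omega}$; the group $[\kappa]^{<\omega}$ with this topology is denoted by $B(\kappa_{\mathscr F})$. *)

theory Defs
  imports "HOL-Analysis.T1_Spaces" "HOL-Algebra.Generated_Groups"
begin

unbundle cardinal_syntax

section \<open>Filters on a set and on a cardinal\<close>

text \<open>A cardinal is given, as in the library, by a relation \<open>\<kappa>\<close> with \<^const>\<open>Card_order\<close>,
  i.e. an initial well-order (reflexive, read as \<open>\<le>\<close>) of its field. The elements of \<open>Field \<kappa>\<close> are the
  ordinals below \<open>\<kappa>\<close>, and \<open>underS \<kappa> \<alpha>\<close> is the set of all \<open>\<beta> < \<alpha>\<close>. Filters are families of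
  subsets of the underlying set, because that set is the field of a relation and need not be a
  whole type.\<close>

definition filter_on :: "'a set \<Rightarrow> 'a set set \<Rightarrow> bool" where
  "filter_on X F \<longleftrightarrow>
     F \<subseteq> Pow X \<and> X \<in> F \<and> {} \<notin> F \<and>
     (\<forall>A\<in>F. \<forall>B\<in>F. A \<inter> B \<in> F) \<and>
     (\<forall>A\<in>F. \<forall>B. A \<subseteq> B \<and> B \<subseteq> X \<longrightarrow> B \<in> F)"

definition ultrafilter_on :: "'a set \<Rightarrow> 'a set set \<Rightarrow> bool" where
  "ultrafilter_on X F \<longleftrightarrow> filter_on X F \<and> (\<forall>A. A \<subseteq> X \<longrightarrow> A \<in> F \<or> X - A \<in> F)"

definition principal_on :: "'a set \<Rightarrow> 'a set set \<Rightarrow> bool" where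
  "principal_on X F \<longleftrightarrow> (\<exists>S. F = {A. S \<subseteq> A \<and> A \<subseteq> X})"

text \<open>The empty family is excluded since \<open>\<Inter>{} = UNIV\<close>; its intersection within the underlying set
  is that set, which lies in every filter.\<close>

definition complete_filter :: "'k rel \<Rightarrow> 'a set set \<Rightarrow> bool" where
  "complete_filter \<kappa> F \<longleftrightarrow> (\<forall>\<A>. \<A> \<subseteq> F \<and> \<A> \<noteq> {} \<and> |\<A>| <o \<kappa> \<longrightarrow> \<Inter>\<A> \<in> F)"

definition diagonal_Inter :: "'a rel \<Rightarrow> ('a \<Rightarrow> 'a set) \<Rightarrow> 'a set" where
  "diagonal_Inter \<delta> X = {\<alpha> \<in> Field \<delta>. \<forall>\<beta> \<in> underS \<delta> \<alpha>. \<alpha> \<in> X \<beta>}"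

definition normal_filter :: "'a rel \<Rightarrow> 'a set set \<Rightarrow> bool" where
  "normal_filter \<kappa> F \<longleftrightarrow> (\<forall>X. (\<forall>\<alpha> \<in> Field \<kappa>. X \<alpha> \<in> F) \<longrightarrow> diagonal_Inter \<kappa> X \<in> F)"


section \<open>Topological notions\<close>

definition topological_group :: "('a, 'b) monoid_scheme \<Rightarrow> 'a topology \<Rightarrow> bool" where
  "topological_group G T \<longleftrightarrow>
     group G \<and> topspace T = carrier G \<and>
     continuous_map (prod_topology T T) T (\<lambda>(x, y). x \<otimes>\<^bsub>G\<^esub> y) \<and>
     continuous_map T T (\<lambda>x. inv\<^bsub>G\<^esub> x)"

definition extremally_disconnected :: "'a topology \<Rightarrow> bool" where
  "extremally_disconnected T \<longleftrightarrow> (\<forall>U. openin T U \<longrightarrow> openin T (T closure_of U))"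

definition discrete_space :: "'a topology \<Rightarrow> bool" where
  "discrete_space T \<longleftrightarrow> T = discrete_topology (topspace T)"

definition P_space :: "'k rel \<Rightarrow> 'a topology \<Rightarrow> bool" where
  "P_space \<kappa> T \<longleftrightarrow>
     (\<forall>\<U>. (\<forall>U\<in>\<U>. openin T U) \<and> |\<U>| <o \<kappa> \<longrightarrow> openin T (topspace T \<inter> \<Inter>\<U>))"


section \<open>The Boolean group of finite subsets and its filter topology\<close>

definition Boolean_group :: "'a set \<Rightarrow> 'a set monoid" where
  "Boolean_group X = \<lparr>carrier = Fpow X, mult = sym_diff, one = {}\<rparr>"

definition Boolean_span :: "'a set \<Rightarrow> 'a set \<Rightarrow> 'a set set" where
  "Boolean_span X A = generate (Boolean_group X) ((\<lambda>a. {a}) ` A)"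

text \<open>The topology in which the cosets of the subgroups generated by the members of \<open>F\<close> form
  neighbourhood bases; see \<open>openin_Boolean_topology\<close> and \<open>Boolean_topology_nhds_zero\<close> below.\<close>

definition Boolean_topology :: "'a set \<Rightarrow> 'a set set \<Rightarrow> 'a set topology" where
  "Boolean_topology X F = topology (\<lambda>U. U \<subseteq> carrier (Boolean_group X) \<and>
     (\<forall>x\<in>U. \<exists>A\<in>F. (\<lambda>y. x \<otimes>\<^bsub>Boolean_group X\<^esub> y) ` Boolean_span X A \<subseteq> U))"

lemma Boolean_group_simps [simp]:
  "carrier (Boolean_group X) = Fpow X"
  "x \<otimes>\<^bsub>Boolean_group X\<^esub> y = sym_diff x y"
  "\<one>\<^bsub>Boolean_group X\<^esub> = {}"
  by (auto simp: Boolean_group_def)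

lemma group_Boolean_group: "group (Boolean_group X)"
proof (rule groupI)
  fix x assume "x \<in> carrier (Boolean_group X)"
  then show "\<exists>y\<in>carrier (Boolean_group X). y \<otimes>\<^bsub>Boolean_group X\<^esub> x = \<one>\<^bsub>Boolean_group X\<^esub>"
    by (intro bexI[of _ x]) auto
qed (auto simp: Fpow_def)

lemma inv_Boolean_group: "x \<in> Fpow X \<Longrightarrow> inv\<^bsub>Boolean_group X\<^esub> x = x"
  by (rule group.inv_equality[OF group_Boolean_group]) auto

lemma Boolean_span_eq_Fpow:
  assumes "A \<subseteq> X"
  shows "Boolean_span X A = Fpow A"
proof
  show "Boolean_span X A \<subseteq> Fpow A"
  proof
    fix x assume "x \<in> Boolean_span X A"
    then have "x \<in> generate (Boolean_group X) ((\<lambda>a. {a}) ` A)"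
      by (simp add: Boolean_span_def)
    then show "x \<in> Fpow A"
    proof induction
      case (inv h)
      then have "h \<in> Fpow X" "h \<in> Fpow A"
        using assms by (auto simp: Fpow_def)
      then show ?case by (simp add: inv_Boolean_group)
    qed (auto simp: Fpow_def)
  qed
  show "Fpow A \<subseteq> Boolean_span X A"
  proof
    fix x assume "x \<in> Fpow A"
    then have "finite x" "x \<subseteq> A" by (auto simp: Fpow_def)
    then show "x \<in> Boolean_span X A"
    proof (induction x rule: finite_induct)
      case empty
      show ?case
        using generate.one[of "Boolean_group X"] by (simp add: Boolean_span_def)
    next
      case (insert a x)
      have "{a} \<otimes>\<^bsub>Boolean_group X\<^esub> x \<in> Boolean_span X A"
        unfolding Boolean_span_def
        by (rule generate.eng[OF generate.incl])
          (use insert in \<open>auto simp: Boolean_span_def\<close>)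
      moreover have "{a} \<otimes>\<^bsub>Boolean_group X\<^esub> x = insert a x"
        using insert by auto
      ultimately show ?case by simp
    qed
  qed
qed

lemma openin_Boolean_topology:
  assumes "filter_on X F"
  shows "openin (Boolean_topology X F) U \<longleftrightarrow>
    U \<subseteq> Fpow X \<and> (\<forall>x\<in>U. \<exists>A\<in>F. sym_diff x ` Fpow A \<subseteq> U)"
proof -
  let ?P = "\<lambda>U. U \<subseteq> carrier (Boolean_group X) \<and>
     (\<forall>x\<in>U. \<exists>A\<in>F. (\<lambda>y. x \<otimes>\<^bsub>Boolean_group X\<^esub> y) ` Boolean_span X A \<subseteq> U)"
  have sub: "\<And>A. A \<in> F \<Longrightarrow> A \<subseteq> X" and int: "\<And>A B. A \<in> F \<Longrightarrow> B \<in> F \<Longrightarrow> A \<inter> B \<in> F"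
    using assms by (auto simp: filter_on_def)
  have P: "?P V \<longleftrightarrow> V \<subseteq> Fpow X \<and> (\<forall>x\<in>V. \<exists>A\<in>F. sym_diff x ` Fpow A \<subseteq> V)" for V
    using sub by (simp add: Boolean_span_eq_Fpow cong: bex_cong)
  have "istopology ?P"
    unfolding istopology_def P
  proof (intro conjI allI impI)
    fix S T
    assume S: "S \<subseteq> Fpow X \<and> (\<forall>x\<in>S. \<exists>A\<in>F. sym_diff x ` Fpow A \<subseteq> S)"
      and T: "T \<subseteq> Fpow X \<and> (\<forall>x\<in>T. \<exists>A\<in>F. sym_diff x ` Fpow A \<subseteq> T)"
    show "S \<inter> T \<subseteq> Fpow X" using S by blast
    show "\<forall>x\<in>S \<inter> T. \<exists>A\<in>F. sym_diff x ` Fpow A \<subseteq> S \<inter> T"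
    proof
      fix x assume "x \<in> S \<inter> T"
      then obtain A B where A: "A \<in> F" "sym_diff x ` Fpow A \<subseteq> S"
        and B: "B \<in> F" "sym_diff x ` Fpow B \<subseteq> T"
        using S T by (meson IntD1 IntD2)
      have "Fpow (A \<inter> B) \<subseteq> Fpow A" "Fpow (A \<inter> B) \<subseteq> Fpow B" by (auto simp: Fpow_def)
      then have "sym_diff x ` Fpow (A \<inter> B) \<subseteq> S \<inter> T"
        using A(2) B(2) by blast
      then show "\<exists>A\<in>F. sym_diff x ` Fpow A \<subseteq> S \<inter> T"
        using int[OF A(1) B(1)] by blast
    qed
  next
    fix \<K>
    assume K: "\<forall>S\<in>\<K>. S \<subseteq> Fpow X \<and> (\<forall>x\<in>S. \<exists>A\<in>F. sym_diff x ` Fpow A \<subseteq> S)"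
    show "\<Union>\<K> \<subseteq> Fpow X" using K by blast
    show "\<forall>x\<in>\<Union>\<K>. \<exists>A\<in>F. sym_diff x ` Fpow A \<subseteq> \<Union>\<K>"
    proof
      fix x assume "x \<in> \<Union>\<K>"
      then obtain S where S: "S \<in> \<K>" "x \<in> S" by blast
      then obtain A where "A \<in> F" "sym_diff x ` Fpow A \<subseteq> S" using K by meson
      then show "\<exists>A\<in>F. sym_diff x ` Fpow A \<subseteq> \<Union>\<K>" using S by blast
    qed
  qed
  then show ?thesis
    unfolding Boolean_topology_def by (simp only: topology_inverse' P)
qed

lemma Boolean_topology_nhds_zero:
  assumes "filter_on X F"
  shows "A \<in> F \<Longrightarrow> openin (Boolean_topology X F) (Boolean_span X A) \<and> {} \<in> Boolean_span X A"
    and "openin (Boolean_topology X F) U \<Longrightarrow> {} \<in> U \<Longrightarrow> \<exists>A\<in>F. Boolean_span X A \<subseteq> U"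
proof -
  have sub: "A \<subseteq> X" if "A \<in> F" for A
    using assms that by (auto simp: filter_on_def)
  show "openin (Boolean_topology X F) (Boolean_span X A) \<and> {} \<in> Boolean_span X A" if "A \<in> F"
    using that sub[OF that]
    by (auto simp: openin_Boolean_topology[OF assms] Boolean_span_eq_Fpow Fpow_def
        intro!: bexI[of _ A])
  show "\<exists>A\<in>F. Boolean_span X A \<subseteq> U" if U: "openin (Boolean_topology X F) U" "{} \<in> U"
  proof -
    obtain A where A: "A \<in> F" "sym_diff {} ` Fpow A \<subseteq> U"
      using U unfolding openin_Boolean_topology[OF assms] by meson
    then have "Boolean_span X A \<subseteq> U"
      by (simp add: Boolean_span_eq_Fpow[OF sub])
    then show ?thesis using A(1) by blast
  qed
qed

end

theory Submission
  imports Defs "HOL-Algebra.Free_Abelian_Groups"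
begin

text \<open>All properties but extremal disconnectedness come from the fact that a nonprincipal
  \<open>\<kappa>\<close>-complete ultrafilter \<open>\<U>\<close> on \<open>\<kappa>\<close> contains the complement of every set of size less than \<open>\<kappa>\<close>: the groups \<open>\<langle>A\<rangle>\<close>, \<open>A \<in> \<U>\<close>, are then closed under intersections of fewer than \<open>\<kappa>\<close>
  members, nontrivial, and small enough to separate points.

  For extremal disconnectedness, regard the elements \<open>s \<triangle> {\<alpha>}\<close>, \<open>\<alpha> < \<kappa>\<close>, as the neighbours of \<open>s\<close>, and
  let \<open>N S\<close> be the set of those \<open>s\<close> for which \<open>\<U>\<close>-almost every neighbour lies in \<open>S\<close>. The heart of the
  proof is that this one-step operator determines the topology
  (\<open>openin_iff_almost_all_neighbours\<close>): \<open>S\<close> is open if and only if \<open>S \<subseteq> N S\<close>. Given \<open>s \<in> S \<subseteq> N S\<close>, a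
  diagonal intersection produces one \<open>A \<in> \<U>\<close> such that, whenever the elements of a finite subset of
  \<open>A\<close> are added to \<open>s\<close> in increasing order, no step leaves \<open>S\<close>; so the whole coset of \<open>\<langle>A\<rangle>\<close> lies in
  \<open>S\<close>. Because \<open>\<U>\<close> is an ultrafilter, \<open>N\<close> commutes with complements, hence \<open>C\<close> is closed if and only
  if \<open>N C \<subseteq> C\<close> (\<open>closedin_iff_almost_all_neighbours\<close>).

  Now let \<open>S\<close> be open. Then \<open>S \<subseteq> N S \<subseteq> N (N S) \<subseteq> \<dots>\<close>, and all these sets lie in the closure of \<open>S\<close>.
  Their union \<open>V\<close> satisfies \<open>V \<subseteq> N V\<close>, so it is open; and \<open>N V \<subseteq> V\<close> by countable completeness, so it
  is closed. Thus the closure of \<open>S\<close> is the open set \<open>V\<close> (\<open>openin_closure_of\<close>).\<close>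


section \<open>Cardinality and order\<close>

lemma card_of_Fpow_less:
  assumes "Card_order \<kappa>" "natLeq <o \<kappa>" "|A| <o \<kappa>"
  shows "|Fpow A| <o \<kappa>"
proof (cases "finite A")
  case True
  then have "finite (Fpow A)"
    by (simp add: Fpow_Pow_finite)
  then have "|Fpow A| <o natLeq"
    by (simp add: finite_iff_ordLess_natLeq)
  then show ?thesis
    using assms(2) by (rule ordLess_transitive)
next
  case False
  then show ?thesis
    using card_of_Fpow_infinite[OF False] assms(3) ordIso_ordLess_trans by blast
qed

lemma card_of_image_less: "|A| <o r \<Longrightarrow> |f ` A| <o r"
  using card_of_image ordLeq_ordLess_trans by blast

lemma Linear_order_finite_max:
  assumes "Linear_order r" "t \<in> Fpow (Field r)" "t \<noteq> {}"
  shows "\<exists>m\<in>t. t \<subseteq> insert m (underS r m)"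
proof -
  have "finite t" "t \<subseteq> Field r"
    using assms(2) by (auto simp: Fpow_def)
  then show ?thesis
    using assms(3)
  proof (induction t rule: finite_induct)
    case (insert x t)
    show ?case
    proof (cases "t = {}")
      case False
      with insert obtain m where m: "m \<in> t" "t \<subseteq> insert m (underS r m)" by auto
      have "m \<in> Field r" "x \<in> Field r" "x \<noteq> m" using insert m by auto
      then have "(x, m) \<in> r \<or> (m, x) \<in> r"
        using assms(1) by (auto simp: order_on_defs total_on_def)
      moreover have "trans r" "antisym r" using assms(1) by (auto simp: order_on_defs)
      ultimately show ?thesis
        using m \<open>x \<noteq> m\<close> by (auto simp: underS_def dest: transD antisymD)
    qed simp
  qed simp
qed

text \<open>Builds a finite set by adding its elements in increasing order, the order in which a diagonal
  intersection gives control over the next element.\<close>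

lemma Fpow_Linear_order_induct [consumes 2, case_names empty insert]:
  assumes "Linear_order r" and "t \<in> Fpow (Field r)"
    and "P {}"
    and "\<And>a t. t \<in> Fpow (Field r) \<Longrightarrow> a \<in> Field r \<Longrightarrow> t \<subseteq> underS r a \<Longrightarrow> P t \<Longrightarrow> P (insert a t)"
  shows "P t"
proof -
  have "finite t" using assms(2) by (simp add: Fpow_def)
  then show ?thesis
    using assms(2)
  proof (induction t rule: finite_psubset_induct)
    case (psubset t)
    show ?case
    proof (cases "t = {}")
      case False
      with psubset Linear_order_finite_max[OF assms(1)]
      obtain m where m: "m \<in> t" "t \<subseteq> insert m (underS r m)" by blast
      have "P (insert m (t - {m}))"
      proof (rule assms(4))
        show "P (t - {m})"
          by (rule psubset.IH) (use m(1) psubset.prems in \<open>auto simp: Fpow_def\<close>)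
      qed (use m psubset.prems in \<open>auto simp: Fpow_def\<close>)
      then show ?thesis using m(1) by (simp add: insert_absorb)
    qed (use assms(3) in simp)
  qed
qed


section \<open>Nonprincipal complete ultrafilters\<close>

locale complete_ultrafilter =
  fixes \<kappa> :: "'a rel" and \<U> :: "'a set set"
  assumes Card_order: "Card_order \<kappa>"
    and uncountable: "natLeq <o \<kappa>"
    and ultrafilter: "ultrafilter_on (Field \<kappa>) \<U>"
    and nonprincipal: "\<not> principal_on (Field \<kappa>) \<U>"
    and complete: "complete_filter \<kappa> \<U>"
begin

abbreviation X :: "'a set" where "X \<equiv> Field \<kappa>"
abbreviation T :: "'a set topology" where "T \<equiv> Boolean_topology X \<U>"

lemma filter_on_X: "filter_on X \<U>"
  using ultrafilter by (simp add: ultrafilter_on_def)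

lemma mem_subset: "A \<in> \<U> \<Longrightarrow> A \<subseteq> X"
  and X_mem: "X \<in> \<U>"
  and empty_not_mem: "{} \<notin> \<U>"
  and Int_mem: "A \<in> \<U> \<Longrightarrow> B \<in> \<U> \<Longrightarrow> A \<inter> B \<in> \<U>"
  and superset_mem: "A \<in> \<U> \<Longrightarrow> A \<subseteq> B \<Longrightarrow> B \<subseteq> X \<Longrightarrow> B \<in> \<U>"
  using filter_on_X by (auto simp: filter_on_def)

lemma Diff_mem_iff: "A \<subseteq> X \<Longrightarrow> X - A \<in> \<U> \<longleftrightarrow> A \<notin> \<U>"
  using ultrafilter Int_mem[of A "X - A"] empty_not_mem by (auto simp: ultrafilter_on_def)

text \<open>Intersecting with the underlying set covers the empty family as well.\<close>

lemma INT_mem: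
  assumes "|I| <o \<kappa>" and "\<And>i. i \<in> I \<Longrightarrow> A i \<in> \<U>"
  shows "X \<inter> (\<Inter>i\<in>I. A i) \<in> \<U>"
proof (cases "I = {}")
  case False
  have "\<Inter>(A ` I) \<in> \<U>"
    using complete card_of_image_less[OF assms(1), of A] False assms(2)
    unfolding complete_filter_def by (simp add: image_subset_iff)
  then show ?thesis by (rule Int_mem[OF X_mem])
qed (simp add: X_mem)

lemma singleton_not_mem: "{a} \<notin> \<U>"
proof
  assume a: "{a} \<in> \<U>"
  have "A \<in> \<U> \<longleftrightarrow> {a} \<subseteq> A \<and> A \<subseteq> X" for A
    using a mem_subset[of A] superset_mem[of "{a}" A] Int_mem[OF a, of A] empty_not_mem
    by (cases "a \<in> A") auto
  then have "\<U> = {A. {a} \<subseteq> A \<and> A \<subseteq> X}" by blast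
  then show False using nonprincipal unfolding principal_on_def by blast
qed

lemma Diff_small_mem:
  assumes "S \<subseteq> X" "|S| <o \<kappa>"
  shows "X - S \<in> \<U>"
proof -
  have "X \<inter> (\<Inter>a\<in>S. X - {a}) \<in> \<U>"
    by (rule INT_mem) (use assms singleton_not_mem in \<open>auto simp: Diff_mem_iff\<close>)
  moreover have "X \<inter> (\<Inter>a\<in>S. X - {a}) = X - S" by auto
  ultimately show ?thesis by simp
qed

lemma finite_less: "finite S \<Longrightarrow> |S| <o \<kappa>"
  using uncountable finite_iff_ordLess_natLeq ordLess_transitive by blast

lemma infinite_X: "infinite X"
  using finite_less[of X] card_of_Field_ordIso[OF Card_order] not_ordLess_ordIso by blast

lemma Un_mem_countable:
  fixes A :: "nat \<Rightarrow> 'a set"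
  assumes "(\<Union>k. A k) \<in> \<U>"
  shows "\<exists>k. A k \<in> \<U>"
proof (rule ccontr)
  assume "\<nexists>k. A k \<in> \<U>"
  moreover have sub: "A k \<subseteq> X" for k using mem_subset[OF assms] by blast
  ultimately have "X - A k \<in> \<U>" for k by (simp add: Diff_mem_iff)
  moreover have "|UNIV :: nat set| <o \<kappa>"
    using card_of_nat uncountable by (rule ordIso_ordLess_trans)
  ultimately have "X \<inter> (\<Inter>k. X - A k) \<in> \<U>" by (intro INT_mem)
  moreover have "X \<inter> (\<Inter>k. X - A k) = X - (\<Union>k. A k)" by blast
  ultimately show False
    using assms mem_subset[OF assms] by (simp add: Diff_mem_iff)
qed


section \<open>The group topology\<close>

lemma openin_T: "openin T V \<longleftrightarrow> V \<subseteq> Fpow X \<and> (\<forall>x\<in>V. \<exists>A\<in>\<U>. sym_diff x ` Fpow A \<subseteq> V)"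
  by (rule openin_Boolean_topology[OF filter_on_X])

lemma open_contains_coset:
  assumes "openin T V" "x \<in> V"
  obtains A where "A \<in> \<U>" "sym_diff x ` Fpow A \<subseteq> V"
  using assms unfolding openin_T by meson

lemma coset_open:
  assumes "x \<in> Fpow X" "A \<in> \<U>"
  shows "openin T (sym_diff x ` Fpow A)"
  unfolding openin_T
proof (intro conjI ballI)
  show "sym_diff x ` Fpow A \<subseteq> Fpow X"
    using assms mem_subset[OF assms(2)] by (auto simp: Fpow_def)
  fix y assume "y \<in> sym_diff x ` Fpow A"
  then obtain s where s: "s \<in> Fpow A" "y = sym_diff x s" by blast
  have "sym_diff y t \<in> sym_diff x ` Fpow A" if "t \<in> Fpow A" for t
  proof (rule image_eqI)
    show "sym_diff y t = sym_diff x (sym_diff s t)" unfolding s by auto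
    show "sym_diff s t \<in> Fpow A" using s that by (auto simp: Fpow_def)
  qed
  then show "\<exists>A'\<in>\<U>. sym_diff y ` Fpow A' \<subseteq> sym_diff x ` Fpow A"
    using assms(2) by blast
qed

lemma coset_subset: "x \<in> Fpow X \<Longrightarrow> A \<in> \<U> \<Longrightarrow> sym_diff x ` Fpow A \<subseteq> Fpow X"
  using coset_open openin_T by meson

lemma mem_coset: "x \<in> sym_diff x ` Fpow A"
  by (rule image_eqI[of _ _ "{}"]) (auto simp: Fpow_def)

lemma topspace_T: "topspace T = Fpow X"
proof -
  have "openin T (Fpow X)"
    unfolding openin_T by (auto simp: Fpow_def intro!: bexI[OF _ X_mem])
  then have "Fpow X \<subseteq> topspace T" by (rule openin_subset)
  moreover have "topspace T \<subseteq> Fpow X"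
    using openin_T[THEN iffD1, OF openin_topspace] by (rule conjunct1)
  ultimately show ?thesis by (rule subset_antisym[rotated])
qed

lemma topological_group_T: "topological_group (Boolean_group X) T"
proof -
  have "continuous_map (prod_topology T T) T (\<lambda>(x, y). sym_diff x y)"
    unfolding continuous_map_def
  proof (intro conjI allI impI)
    show "(\<lambda>(x, y). sym_diff x y) \<in> topspace (prod_topology T T) \<rightarrow> topspace T"
      by (auto simp: topspace_T Fpow_def)
    fix W assume W: "openin T W"
    show "openin (prod_topology T T)
        {p \<in> topspace (prod_topology T T). (case p of (x, y) \<Rightarrow> sym_diff x y) \<in> W}"
      unfolding openin_prod_topology_alt
    proof (intro allI impI)
      fix x y
      assume "(x, y) \<in> {p \<in> topspace (prod_topology T T). (case p of (x, y) \<Rightarrow> sym_diff x y) \<in> W}"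
      then have xy: "x \<in> Fpow X" "y \<in> Fpow X" "sym_diff x y \<in> W"
        by (auto simp: topspace_T)
      obtain A where A: "A \<in> \<U>" "sym_diff (sym_diff x y) ` Fpow A \<subseteq> W"
        using W xy(3) by (rule open_contains_coset)
      have "sym_diff (sym_diff x s) (sym_diff y t) \<in> W" if "s \<in> Fpow A" "t \<in> Fpow A" for s t
      proof -
        have "sym_diff s t \<in> Fpow A" using that by (auto simp: Fpow_def)
        moreover have "sym_diff (sym_diff x s) (sym_diff y t)
            = sym_diff (sym_diff x y) (sym_diff s t)" by auto
        ultimately show ?thesis using A(2) by auto
      qed
      moreover have "sym_diff x ` Fpow A \<subseteq> Fpow X" "sym_diff y ` Fpow A \<subseteq> Fpow X"
        using coset_subset[OF _ A(1)] xy(1,2) by simp_all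
      ultimately have "sym_diff x ` Fpow A \<times> sym_diff y ` Fpow A
          \<subseteq> {p \<in> topspace (prod_topology T T). (case p of (x, y) \<Rightarrow> sym_diff x y) \<in> W}"
        by (auto simp: topspace_T)
      then show "\<exists>U V. openin T U \<and> openin T V \<and> x \<in> U \<and> y \<in> V \<and> U \<times> V
          \<subseteq> {p \<in> topspace (prod_topology T T). (case p of (x, y) \<Rightarrow> sym_diff x y) \<in> W}"
        using coset_open[OF xy(1) A(1)] coset_open[OF xy(2) A(1)] mem_coset
        by (intro exI[of _ "sym_diff x ` Fpow A"] exI[of _ "sym_diff y ` Fpow A"] conjI)
    qed
  qed
  moreover have "continuous_map T T (\<lambda>x. inv\<^bsub>Boolean_group X\<^esub> x)"
    by (rule continuous_map_eq[OF continuous_map_id])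
      (simp add: topspace_T inv_Boolean_group)
  ultimately show ?thesis
    by (simp add: topological_group_def group_Boolean_group topspace_T)
qed

text \<open>If \<open>x \<triangle> s = y \<triangle> t\<close>, then \<open>x \<triangle> y = s \<triangle> t\<close>; so the cosets of \<open>\<langle>A\<rangle>\<close> through \<open>x\<close> and \<open>y\<close> are
  disjoint as soon as \<open>A\<close> avoids the finite nonempty set \<open>x \<triangle> y\<close>.\<close>

lemma Hausdorff_T: "Hausdorff_space T"
  unfolding Hausdorff_space_def
proof (intro allI impI)
  fix x y assume "x \<in> topspace T \<and> y \<in> topspace T \<and> x \<noteq> y"
  then have xy: "x \<in> Fpow X" "y \<in> Fpow X" "x \<noteq> y" by (auto simp: topspace_T)
  let ?A = "X - sym_diff x y"
  have A: "?A \<in> \<U>"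
  proof (rule Diff_small_mem)
    show "sym_diff x y \<subseteq> X" using xy(1,2) by (auto simp: Fpow_def)
    show "|sym_diff x y| <o \<kappa>" using xy(1,2) by (intro finite_less) (simp add: Fpow_def)
  qed
  have "disjnt (sym_diff x ` Fpow ?A) (sym_diff y ` Fpow ?A)"
    unfolding disjnt_iff
  proof (intro allI notI)
    fix z assume "z \<in> sym_diff x ` Fpow ?A \<and> z \<in> sym_diff y ` Fpow ?A"
    then obtain s t
      where st: "s \<in> Fpow ?A" "t \<in> Fpow ?A" "z = sym_diff x s" "z = sym_diff y t"
      by blast
    have "sym_diff x y = sym_diff s t" using trans[OF st(3)[symmetric] st(4)] by blast
    moreover have "sym_diff s t \<subseteq> ?A" using st(1,2) by (auto simp: Fpow_def)
    ultimately show False using xy(3) by blast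
  qed
  then show "\<exists>U V. openin T U \<and> openin T V \<and> x \<in> U \<and> y \<in> V \<and> disjnt U V"
    using coset_open[OF xy(1) A] coset_open[OF xy(2) A] mem_coset
    by (intro exI[of _ "sym_diff x ` Fpow ?A"] exI[of _ "sym_diff y ` Fpow ?A"] conjI)
qed

lemma not_discrete_T: "\<not> discrete_space T"
proof
  assume discrete: "discrete_space T"
  have "openin (discrete_topology (topspace T)) {{}}"
    by (simp add: topspace_T empty_in_Fpow)
  then have "openin T {{}}"
    by (rule ssubst[OF discrete[unfolded discrete_space_def], of "\<lambda>Y. openin Y {{}}"])
  then obtain A where A: "A \<in> \<U>" "sym_diff {} ` Fpow A \<subseteq> {{}}"
    by (rule open_contains_coset[OF _ singletonI])
  have "A \<noteq> {}" using A(1) empty_not_mem by metis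
  then obtain a where "a \<in> A" by blast
  then have "{a} \<in> Fpow A" by (auto simp: Fpow_def)
  then show False using A(2) by auto
qed

lemma P_space_T: "P_space \<kappa> T"
  unfolding P_space_def
proof (intro allI impI)
  fix \<V> assume V: "(\<forall>V\<in>\<V>. openin T V) \<and> |\<V>| <o \<kappa>"
  show "openin T (topspace T \<inter> \<Inter>\<V>)"
    unfolding openin_T
  proof (intro conjI ballI)
    show "topspace T \<inter> \<Inter>\<V> \<subseteq> Fpow X" by (simp add: topspace_T)
    fix x assume x: "x \<in> topspace T \<inter> \<Inter>\<V>"
    then have "\<forall>V\<in>\<V>. \<exists>A\<in>\<U>. sym_diff x ` Fpow A \<subseteq> V"
      using V unfolding openin_T by (meson IntD2 InterD)
    then obtain A where A: "\<And>V. V \<in> \<V> \<Longrightarrow> A V \<in> \<U> \<and> sym_diff x ` Fpow (A V) \<subseteq> V"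
      by metis
    let ?B = "X \<inter> (\<Inter>V\<in>\<V>. A V)"
    have B: "?B \<in> \<U>"
      by (rule INT_mem) (use V A in auto)
    have "sym_diff x ` Fpow ?B \<subseteq> V" if "V \<in> \<V>" for V
    proof -
      have "Fpow ?B \<subseteq> Fpow (A V)" using that by (intro Fpow_mono) auto
      then have "sym_diff x ` Fpow ?B \<subseteq> sym_diff x ` Fpow (A V)"
        by (rule image_mono)
      also have "\<dots> \<subseteq> V" using A[OF that] by simp
      finally show ?thesis .
    qed
    moreover have "sym_diff x ` Fpow ?B \<subseteq> topspace T"
      using x unfolding topspace_T by (intro coset_subset B) blast
    ultimately have "sym_diff x ` Fpow ?B \<subseteq> topspace T \<inter> \<Inter>\<V>"
      by (intro Int_greatest Inter_greatest)
    then show "\<exists>A\<in>\<U>. sym_diff x ` Fpow A \<subseteq> topspace T \<inter> \<Inter>\<V>"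
      using B by (rule bexI)
  qed
qed

text \<open>The complement of a small set is an intersection of few complements of points, and these are
  open.\<close>

lemma small_closed:
  assumes "S \<subseteq> topspace T" "|S| <o \<kappa>"
  shows "closedin T S"
proof -
  have "openin T (topspace T \<inter> \<Inter>((\<lambda>x. topspace T - {x}) ` S))"
  proof -
    have "openin T (topspace T - {x})" if "x \<in> S" for x
      using that assms(1)
      by (intro openin_diff openin_topspace closedin_Hausdorff_singleton[OF Hausdorff_T]) blast
    then show ?thesis
      by (intro P_space_T[unfolded P_space_def, rule_format] conjI card_of_image_less[OF assms(2)])
        auto
  qed
  moreover have "topspace T \<inter> \<Inter>((\<lambda>x. topspace T - {x}) ` S) = topspace T - S" by auto
  ultimately show ?thesis using assms(1) by (simp add: closedin_def)
qed

text \<open>Every subset of a small set is again small, hence closed.\<close>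

lemma small_discrete:
  assumes "S \<subseteq> topspace T" "|S| <o \<kappa>"
  shows "discrete_space (subtopology T S)"
proof -
  have top: "topspace (subtopology T S) = S" using assms(1) by auto
  have "openin (subtopology T S) {x}" if "x \<in> S" for x
  proof -
    have "closedin T (S - {x})"
    proof (rule small_closed)
      show "|S - {x}| <o \<kappa>"
        by (rule ordLeq_ordLess_trans[OF card_of_mono1 assms(2)]) blast
    qed (use assms(1) in blast)
    then have "openin T (topspace T - (S - {x}))" by blast
    moreover have "{x} = (topspace T - (S - {x})) \<inter> S" using that assms(1) by auto
    ultimately show ?thesis unfolding openin_subtopology by blast
  qed
  then have "discrete_topology S = subtopology T S"
    unfolding discrete_topology_unique using top by blast
  then show ?thesis unfolding discrete_space_def top by simp
qed


section \<open>The one-step neighbour operator\<close>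

text \<open>The operator \<open>N\<close> of the introduction: the limit along \<open>\<U>\<close> of the translates of \<open>S\<close> by the
  generators of the group.\<close>

definition almost_all_neighbours :: "'a set set \<Rightarrow> 'a set set" where
  "almost_all_neighbours S = {s \<in> Fpow X. {a \<in> X. sym_diff s {a} \<in> S} \<in> \<U>}"

lemma almost_all_neighbours_mono: "S \<subseteq> S' \<Longrightarrow> almost_all_neighbours S \<subseteq> almost_all_neighbours S'"
  unfolding almost_all_neighbours_def by (auto elim!: superset_mem)

text \<open>Here the ultrafilter property enters: if not almost every neighbour lies in \<open>S\<close>, then almost every
  neighbour lies outside.\<close>

lemma almost_all_neighbours_Diff:
  "almost_all_neighbours (Fpow X - S) = Fpow X - almost_all_neighbours S"
proof -
  have "{a \<in> X. sym_diff s {a} \<in> Fpow X - S} = X - {a \<in> X. sym_diff s {a} \<in> S}"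
    if "s \<in> Fpow X" for s
    using that by (auto simp: Fpow_def)
  then show ?thesis
    by (auto simp: almost_all_neighbours_def Diff_mem_iff)
qed

lemma open_subset_almost_all_neighbours:
  assumes "openin T S"
  shows "S \<subseteq> almost_all_neighbours S"
proof
  fix s assume s: "s \<in> S"
  obtain A where A: "A \<in> \<U>" "sym_diff s ` Fpow A \<subseteq> S"
    using assms s by (rule open_contains_coset)
  have "A \<subseteq> {a \<in> X. sym_diff s {a} \<in> S}"
  proof
    fix a assume a: "a \<in> A"
    then have "{a} \<in> Fpow A" by (simp add: Fpow_def)
    then have "sym_diff s {a} \<in> S" by (rule subsetD[OF A(2) imageI])
    then show "a \<in> {a \<in> X. sym_diff s {a} \<in> S}"
      using a mem_subset[OF A(1)] by blast
  qed
  then have "{a \<in> X. sym_diff s {a} \<in> S} \<in> \<U>"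
    by (rule superset_mem[OF A(1)]) blast
  moreover have "s \<in> Fpow X" using openin_subset[OF assms] s topspace_T by auto
  ultimately show "s \<in> almost_all_neighbours S"
    by (simp add: almost_all_neighbours_def)
qed

end


section \<open>Normality and extremal disconnectedness\<close>

locale normal_ultrafilter = complete_ultrafilter +
  assumes normal: "normal_filter \<kappa> \<U>"
begin

text \<open>In the nontrivial direction, there are fewer than \<open>\<kappa>\<close> finite sets with a given maximum \<open>\<beta>\<close>, so by
  completeness a single \<open>Z \<beta> \<in> \<U>\<close> consists of good next elements for all of them. The diagonal
  intersection of the \<open>Z \<beta>\<close> makes every \<open>\<alpha>\<close> a good next element for all nonempty
  finite sets below \<open>\<alpha>\<close>.\<close>

lemma openin_iff_almost_all_neighbours:
  "openin T S \<longleftrightarrow> S \<subseteq> Fpow X \<and> S \<subseteq> almost_all_neighbours S"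
proof
  assume "openin T S"
  then show "S \<subseteq> Fpow X \<and> S \<subseteq> almost_all_neighbours S"
    using open_subset_almost_all_neighbours openin_T by blast
next
  assume S: "S \<subseteq> Fpow X \<and> S \<subseteq> almost_all_neighbours S"
  have lin: "Linear_order \<kappa>"
    using Card_order by (simp add: card_order_on_well_order_on well_order_on_Well_order wo_rel.LIN wo_rel_def)
  show "openin T S"
    unfolding openin_T
  proof (intro conjI ballI)
    show "S \<subseteq> Fpow X" using S by blast
    fix s assume s: "s \<in> S"
    \<comment> \<open>\<open>Y t\<close>: the good next elements after \<open>t\<close> has been added; no constraint if \<open>s \<triangle> t\<close> already left \<open>S\<close>.\<close>
    define Y where "Y t = (if sym_diff s t \<in> S then {a \<in> X. sym_diff s (sym_diff t {a}) \<in> S} else X)"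
      for t
    have Y: "Y t \<in> \<U>" for t
    proof -
      have "sym_diff (sym_diff s t) {a} = sym_diff s (sym_diff t {a})" for a by auto
      then show ?thesis
        using S X_mem by (auto simp: Y_def almost_all_neighbours_def)
    qed
    define Z where "Z b = X \<inter> (\<Inter>t\<in>Fpow (insert b (underS \<kappa> b)). Y t)" for b
    have Z: "Z b \<in> \<U>" if "b \<in> X" for b
      unfolding Z_def
    proof (rule INT_mem)
      have "|{b}| <o \<kappa>" by (simp add: finite_less)
      then have "|{b} \<union> underS \<kappa> b| <o \<kappa>"
        using card_of_underS[OF Card_order that]
        by (rule card_of_Un_ordLess_infinite_Field[OF infinite_X Card_order])
      then show "|Fpow (insert b (underS \<kappa> b))| <o \<kappa>"
        using card_of_Fpow_less[OF Card_order uncountable] by simp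
    qed (rule Y)
    \<comment> \<open>The diagonal intersection governs only the step after a nonempty set; the first step needs \<open>Y {}\<close>.\<close>
    define A where "A = Y {} \<inter> diagonal_Inter \<kappa> Z"
    have A: "A \<in> \<U>"
      unfolding A_def using normal Z Y Int_mem unfolding normal_filter_def by blast
    have "t \<subseteq> A \<longrightarrow> sym_diff s t \<in> S" if "t \<in> Fpow X" for t
      using lin that
    proof (induction t rule: Fpow_Linear_order_induct)
      case empty
      show ?case using s by simp
    next
      case (insert a t)
      show ?case
      proof
        assume sub: "insert a t \<subseteq> A"
        then have IH: "sym_diff s t \<in> S" using insert.IH by blast
        have "a \<in> Y t"
        proof (cases "t = {}")
          case True
          then show ?thesis using sub by (simp add: A_def)
        next
          case False
          then obtain b where b: "b \<in> t" "t \<subseteq> insert b (underS \<kappa> b)"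
            using Linear_order_finite_max[OF lin] insert.hyps(1) by blast
          have "a \<in> Z b"
            using sub b(1) insert.hyps(3) by (auto simp: A_def diagonal_Inter_def)
          moreover have "t \<in> Fpow (insert b (underS \<kappa> b))"
            using b(2) insert.hyps(1) by (auto simp: Fpow_def)
          ultimately show ?thesis unfolding Z_def by blast
        qed
        then have "sym_diff s (sym_diff t {a}) \<in> S" using IH by (simp add: Y_def)
        moreover have "sym_diff t {a} = insert a t"
          using insert.hyps by (auto simp: underS_def)
        ultimately show "sym_diff s (insert a t) \<in> S" by simp
      qed
    qed
    then have "sym_diff s ` Fpow A \<subseteq> S"
      using mem_subset[OF A] by (auto simp: Fpow_def)
    then show "\<exists>A\<in>\<U>. sym_diff s ` Fpow A \<subseteq> S" using A by blast
  qed
qed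

lemma closedin_iff_almost_all_neighbours:
  "closedin T C \<longleftrightarrow> C \<subseteq> Fpow X \<and> almost_all_neighbours C \<subseteq> C"
proof -
  have "almost_all_neighbours C \<subseteq> Fpow X" by (auto simp: almost_all_neighbours_def)
  then show ?thesis
    by (auto simp: closedin_def topspace_T openin_iff_almost_all_neighbours
        almost_all_neighbours_Diff)
qed

text \<open>The closure of an open set is reached by iterating the operator \<open>\<omega>\<close> times: if almost every
  neighbour of \<open>s\<close> lies in the union of countably many sets, then almost every one lies in one of them.\<close>

lemma openin_closure_of:
  assumes "openin T S"
  shows "openin T (T closure_of S)"
proof -
  let ?N = almost_all_neighbours
  define V where "V = (\<Union>k. (?N ^^ k) S)"
  have sub: "(?N ^^ k) S \<subseteq> T closure_of S" for k
  proof (induction k)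
    case 0
    show ?case using closure_of_subset[OF openin_subset[OF assms]] by simp
  next
    case (Suc k)
    have "?N (T closure_of S) \<subseteq> T closure_of S"
      using closedin_iff_almost_all_neighbours[THEN iffD1, OF closedin_closure_of] by (rule conjunct2)
    with almost_all_neighbours_mono[OF Suc] have "?N ((?N ^^ k) S) \<subseteq> T closure_of S"
      by (rule subset_trans)
    then show ?case by simp
  qed
  then have V_sub: "V \<subseteq> T closure_of S" unfolding V_def by (rule UN_least)
  also have "\<dots> \<subseteq> Fpow X" using closure_of_subset_topspace[of T S] by (simp only: topspace_T)
  finally have VX: "V \<subseteq> Fpow X" .
  have iterate_sub: "(?N ^^ k) S \<subseteq> V" for k
    unfolding V_def by (rule UN_upper) simp
  have S_sub: "S \<subseteq> V" using iterate_sub[of 0] by simp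
  have "(?N ^^ k) S \<subseteq> ?N V" for k
  proof (cases k)
    case 0
    then show ?thesis
      using subset_trans[OF open_subset_almost_all_neighbours[OF assms]
          almost_all_neighbours_mono[OF S_sub]]
      by simp
  next
    case (Suc j)
    then show ?thesis using almost_all_neighbours_mono[OF iterate_sub[of j]] by simp
  qed
  then have "V \<subseteq> ?N V" by (subst V_def) (rule UN_least)
  with VX have V_open: "openin T V" by (simp add: openin_iff_almost_all_neighbours)
  have "?N V \<subseteq> V"
  proof
    fix s assume s: "s \<in> ?N V"
    have "{a \<in> X. sym_diff s {a} \<in> V} = (\<Union>k. {a \<in> X. sym_diff s {a} \<in> (?N ^^ k) S})"
      by (auto simp: V_def)
    then have "(\<Union>k. {a \<in> X. sym_diff s {a} \<in> (?N ^^ k) S}) \<in> \<U>"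
      using s by (simp add: almost_all_neighbours_def)
    then obtain k where "{a \<in> X. sym_diff s {a} \<in> (?N ^^ k) S} \<in> \<U>"
      using Un_mem_countable[of "\<lambda>k. {a \<in> X. sym_diff s {a} \<in> (?N ^^ k) S}"] by auto
    then have "s \<in> (?N ^^ Suc k) S"
      using s by (simp add: almost_all_neighbours_def)
    then show "s \<in> V" by (rule subsetD[OF iterate_sub])
  qed
  with VX have "closedin T V" by (simp add: closedin_iff_almost_all_neighbours)
  with S_sub have "T closure_of S \<subseteq> V" by (rule closure_of_minimal)
  with V_sub have "V = T closure_of S" by (rule subset_antisym)
  then show ?thesis using V_open by simp
qed

end

theorem mainTheorem1:
  fixes \<kappa> :: "'a rel" and \<U> :: "'a set set"
  assumes "Card_order \<kappa>" and "natLeq <o \<kappa>"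
    and "ultrafilter_on (Field \<kappa>) \<U>"
    and "\<not> principal_on (Field \<kappa>) \<U>"
    and "complete_filter \<kappa> \<U>"
    and "normal_filter \<kappa> \<U>"
  shows "topological_group (Boolean_group (Field \<kappa>)) (Boolean_topology (Field \<kappa>) \<U>)
    \<and> \<not> discrete_space (Boolean_topology (Field \<kappa>) \<U>)
    \<and> Hausdorff_space (Boolean_topology (Field \<kappa>) \<U>)
    \<and> extremally_disconnected (Boolean_topology (Field \<kappa>) \<U>)
    \<and> (\<forall>S. S \<subseteq> topspace (Boolean_topology (Field \<kappa>) \<U>) \<and> |S| <o \<kappa> \<longrightarrow>
          closedin (Boolean_topology (Field \<kappa>) \<U>) S
          \<and> discrete_space (subtopology (Boolean_topology (Field \<kappa>) \<U>) S))
    \<and> P_space \<kappa> (Boolean_topology (Field \<kappa>) \<U>)"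
proof -
  interpret normal_ultrafilter \<kappa> \<U>
    using assms by unfold_locales
  show ?thesis
    using topological_group_T not_discrete_T Hausdorff_T openin_closure_of small_closed
      small_discrete P_space_T
    by (simp add: extremally_disconnected_def)
qed

end
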